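(* Let $d\in\mathbb{R}$, let $\alpha(z)=\sum_{i=0}^p(-\alpha_i)z^i$ and $\beta(z)=\sum_{j=0}^q(-\beta_j)z^j$ be real polynomials with $\alpha_0=\beta_0=-1$, without common roots and with $\beta(z)\ne0$ for $|z|\le1$, and let $\lambda_{d,k}$ be the coefficients of $\lambda(z)=\frac{\alpha(z)}{\beta(z)}(1-z)^{-d}=\sum_{k=0}^\infty\lambda_{d,k}z^k$, $|z|<1$. Then $$\lambda_{d,0}=1\quad\text{and}\quad \lambda_{d,k}=-\alpha_k^*+\sum_{i=0}^{k-1}\lambda_{d,i}\sum_{j=0}^{k-i}\beta_j^*\,\delta_{d,k-i-j}\quad\text{for all }k\ge1,$$ where $\alpha_m^*=\alpha_m$ if $0\le m\le p$ and $\alpha_m^*=0$ if $m>p$; $\beta_m^*=\beta_m$ if $0\le m\le q$ and $\beta_m^*=0$ if $m>q$; and $\delta_{d,k}$ are the coefficients of the power series $(1-z)^d=\sum_{k=0}^\infty\delta_{d,k}z^k$.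
   Context: The coefficients of $(1-z)^d$ satisfy $\delta_{d,0}=1$ and $\delta_{d,k}=\delta_{d,k-1}\frac{k-1-d}{k}$ for $k\ge1$. Powers $(1-z)^{\pm d}$ denote the analytic branch on $|z|<1$ equal to $1$ at $z=0$. *)

theory Defs
  imports "HOL-Analysis.Analysis"
begin

text \<open>
  The bound \<open>n\<close> need not be the exact degree: \<open>c n = 0\<close> is allowed.
\<close>

definition lag_poly :: "nat \<Rightarrow> (nat \<Rightarrow> real) \<Rightarrow> complex \<Rightarrow> complex"
  where "lag_poly n c z = (\<Sum>i\<le>n. complex_of_real (- c i) * z ^ i)"

definition zero_ext :: "nat \<Rightarrow> (nat \<Rightarrow> real) \<Rightarrow> nat \<Rightarrow> real"
  where "zero_ext n c m = (if m \<le> n then c m else 0)"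

text \<open>
  On the open unit disc \<open>1 - z\<close> lies in the right half-plane, so the principal power
  \<open>(1 - z) powr s\<close> is analytic there and equals \<open>1\<close> at \<open>z = 0\<close>.
\<close>

definition has_power_series_coeffs :: "(complex \<Rightarrow> complex) \<Rightarrow> (nat \<Rightarrow> complex) \<Rightarrow> bool"
  where "has_power_series_coeffs f c \<longleftrightarrow> (\<forall>z. norm z < 1 \<longrightarrow> (\<lambda>k. c k * z ^ k) sums f z)"

end

theory Submission
  imports Defs
begin

text \<open>On the open unit disc, multiplying \<lambda>(z) by \<beta>(z) (1-z)^d clears the
  denominator and the negative power, leaving \<alpha>(z). By uniqueness of power series
  (\<open>eval_fps_eqD\<close>) this identity of functions becomes an identity
  \<open>L * (B * D) = A\<close> of formal series, to be compared coefficientwise. The series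
  \<open>B * D\<close> has constant term 1, because \<beta>(0) = 1 and (1-z)^d is 1 at 0; so the
  Cauchy product contains \<open>lam k\<close> with coefficient 1, and solving for it gives the
  recurrence. \<open>fps_of_power_series_coeffs\<close> supplies the passage between functions and
  formal series.\<close>

text \<open>Convergence at every real point in (0,1) already forces the radius bound, which is what
  licenses evaluating products of formal series factor by factor.\<close>

lemma fps_of_power_series_coeffs:
  assumes "has_power_series_coeffs f c"
  shows "fps_conv_radius (Abs_fps c) \<ge> 1"
    and "norm z < 1 \<Longrightarrow> eval_fps (Abs_fps c) z = f z"
proof -
  show "fps_conv_radius (Abs_fps c) \<ge> 1"
    unfolding fps_conv_radius_def
  proof (rule conv_radius_geI_ex')
    fix r :: real
    assume "0 < r" "ereal r < 1"
    then have "norm (of_real r :: complex) < 1"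
      by (simp add: one_ereal_def)
    then have "(\<lambda>n. c n * of_real r ^ n) sums f (of_real r)"
      using assms unfolding has_power_series_coeffs_def by blast
    then show "summable (\<lambda>n. fps_nth (Abs_fps c) n * of_real r ^ n)"
      unfolding fps_nth_Abs_fps by (rule sums_summable)
  qed
  show "eval_fps (Abs_fps c) z = f z" if "norm z < 1"
    using assms that unfolding has_power_series_coeffs_def eval_fps_def
    by (simp add: sums_iff)
qed

text \<open>Puts the polynomials on the same footing as the two given series; the minus sign is the
  one built into \<open>lag_poly\<close>.\<close>

lemma has_power_series_coeffs_lag_poly:
  "has_power_series_coeffs (lag_poly n c) (\<lambda>k. - complex_of_real (zero_ext n c k))"
  unfolding has_power_series_coeffs_def
proof (intro allI impI)
  fix z :: complex
  have "(\<lambda>k. - complex_of_real (zero_ext n c k) * z ^ k) sums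
        (\<Sum>k\<le>n. - complex_of_real (zero_ext n c k) * z ^ k)"
    by (rule sums_finite) (auto simp: zero_ext_def)
  then show "(\<lambda>k. - complex_of_real (zero_ext n c k) * z ^ k) sums lag_poly n c z"
    by (simp add: lag_poly_def zero_ext_def)
qed

theorem proposition2:
  fixes d :: real and p q :: nat
    and \<alpha> \<beta> :: "nat \<Rightarrow> real"
    and lam \<delta> :: "nat \<Rightarrow> complex"
  assumes "\<alpha> 0 = -1" and "\<beta> 0 = -1"
    and "\<not> (\<exists>z. lag_poly p \<alpha> z = 0 \<and> lag_poly q \<beta> z = 0)"
    and "\<And>z. norm z \<le> 1 \<Longrightarrow> lag_poly q \<beta> z \<noteq> 0"
    and "has_power_series_coeffs
           (\<lambda>z. lag_poly p \<alpha> z / lag_poly q \<beta> z * (1 - z) powr (- complex_of_real d)) lam"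
    and "has_power_series_coeffs (\<lambda>z. (1 - z) powr (complex_of_real d)) \<delta>"
  shows "lam 0 = 1 \<and>
    (\<forall>k\<ge>1. lam k = - complex_of_real (zero_ext p \<alpha> k)
       + (\<Sum>i<k. lam i * (\<Sum>j\<le>k - i. complex_of_real (zero_ext q \<beta> j) * \<delta> (k - i - j))))"
proof -
  define L where "L = Abs_fps lam"
  define D where "D = Abs_fps \<delta>"
  define A where "A = Abs_fps (\<lambda>k. - complex_of_real (zero_ext p \<alpha> k))"
  define B where "B = Abs_fps (\<lambda>k. - complex_of_real (zero_ext q \<beta> k))"
  note L = fps_of_power_series_coeffs[OF assms(5), folded L_def]
  note D = fps_of_power_series_coeffs[OF assms(6), folded D_def]
  note A = fps_of_power_series_coeffs[OF has_power_series_coeffs_lag_poly[of p \<alpha>], folded A_def]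
  note B = fps_of_power_series_coeffs[OF has_power_series_coeffs_lag_poly[of q \<beta>], folded B_def]
  \<comment> \<open>The grouping \<open>L * (B * D)\<close> mirrors the claim: its inner sum over j
    is, up to sign, a coefficient of \<open>B * D\<close>.\<close>
  have BD_radius: "fps_conv_radius (B * D) \<ge> 1"
    using fps_conv_radius_mult[of B D] B(1) D(1) by (meson min.boundedI order_trans)
  have LBD_radius: "fps_conv_radius (L * (B * D)) \<ge> 1"
    using fps_conv_radius_mult[of L "B * D"] L(1) BD_radius by (meson min.boundedI order_trans)
  have eval: "eval_fps (L * (B * D)) z = eval_fps A z" if z: "norm z < 1" for z
  proof -
    have inside: "ereal (norm z) < r" if "r \<ge> 1" for r
      using z that by (metis ereal_less(3) less_le_trans)
    \<comment> \<open>Since \<open>0 powr s = 0\<close>, the powers with exponents d and -d cancel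
      only for a nonzero base 1 - z.\<close>
    have "z \<noteq> 1"
      using z by auto
    have "eval_fps (L * (B * D)) z = eval_fps L z * (eval_fps B z * eval_fps D z)"
      using inside L(1) B(1) D(1) BD_radius by (simp add: eval_fps_mult)
    also have "\<dots> = eval_fps A z"
      using assms(4)[of z] z \<open>z \<noteq> 1\<close>
      by (simp add: L(2) B(2) D(2) A(2) powr_minus)
    finally show ?thesis .
  qed
  have product: "L * (B * D) = A"
  proof (rule eval_fps_eqD)
    show "fps_conv_radius (L * (B * D)) > 0" "fps_conv_radius A > 0"
      using LBD_radius A(1) by (auto intro: less_le_trans[of 0 1])
    have "\<forall>\<^sub>F z in nhds 0. z \<in> ball (0 :: complex) 1"
      by (intro eventually_nhds_in_open) auto
    then show "\<forall>\<^sub>F z in nhds 0. eval_fps (L * (B * D)) z = eval_fps A z"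
      by eventually_elim (simp add: eval)
  qed
  have \<delta>_0: "\<delta> 0 = 1"
    using D(2)[of 0] by (simp add: D_def eval_fps_at_0)
  define c where "c m = (\<Sum>j\<le>m. complex_of_real (zero_ext q \<beta> j) * \<delta> (m - j))" for m
  have BD_nth: "fps_nth (B * D) m = - c m" for m
    by (simp add: fps_mult_nth B_def D_def c_def atMost_atLeast0 sum_negf)
  \<comment> \<open>This normalization lets the term i = k of the Cauchy product be solved for
    \<open>lam k\<close> without division.\<close>
  have c_0: "c 0 = -1"
    using assms(2) \<delta>_0 by (simp add: c_def zero_ext_def)
  have rec: "lam k = - complex_of_real (zero_ext p \<alpha> k) + (\<Sum>i<k. lam i * c (k - i))" for k
  proof -
    have "- complex_of_real (zero_ext p \<alpha> k) = fps_nth (L * (B * D)) k"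
      by (simp add: product A_def)
    also have "\<dots> = - (\<Sum>i\<le>k. lam i * c (k - i))"
      unfolding fps_mult_nth[of L] BD_nth
      by (simp only: L_def fps_nth_Abs_fps atMost_atLeast0 mult_minus_right sum_negf)
    also have "\<dots> = lam k - (\<Sum>i<k. lam i * c (k - i))"
      unfolding lessThan_Suc_atMost[symmetric] sum.lessThan_Suc by (simp add: c_0)
    finally show ?thesis
      by (simp add: algebra_simps)
  qed
  \<comment> \<open>The recurrence \<open>rec\<close> also holds at k = 0, where the sum is empty
    and only -\<alpha> 0 = 1 remains.\<close>
  have "lam 0 = 1"
    using rec[of 0] assms(1) by (simp add: zero_ext_def)
  with rec show ?thesis
    unfolding c_def by blast
qed

end
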